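(* For any graphs $G$ and $H$, $$\rho_e^o(G\times H)\ge \max\bigl\{\rho_e^o(G)\,\delta(H)\,\rho^o(H),\ \rho_e^o(H)\,\delta(G)\,\rho^o(G)\bigr\}.$$ Moreover, this bound is sharp, that is, there exist graphs $G$ and $H$ for which equality holds.
   Context: All graphs are finite and simple. A set $B\subseteq E(G)$ is an edge open packing set (EOP set) of $G$ if for any two distinct edges $e_1,e_2\in B$ there is no edge $e\in E(G)\setminus\{e_1,e_2\}$ joining an endvertex of $e_1$ to an endvertex of $e_2$ (that is, no edge $e$ such that $e_1,e,e_2$ form a path with middle edge $e$ or a triangle). Edges of $B$ may share an endvertex. The maximum cardinality of an EOP set is the EOP number $\rho_e^o(G)$. $\delta(G)$ is the minimum degree of $G$. A set $P\subseteq V(G)$ is an open packing if $N(u)\cap N(v)=\emptyset$ for any distinct $u,v\in P$, where $N(u)$ is the open neighborhood of $u$; the open packing number $\rho^o(G)$ is the maximum cardinality of an open packing in $G$. The direct product $G\times H$ has vertex set $V(G)\times V(H)$, and $(g,h)$, $(g',h')$ are adjacent if $gg'\in E(G)$ and $hh'\in E(H)$. *)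

theory Defs
  imports Main
begin

datatype 'a graph = Graph (verts: "'a set") (edges: "'a set set")

definition finite_simple_graph :: "'a graph \<Rightarrow> bool" where
  "finite_simple_graph G \<longleftrightarrow>
     finite (verts G) \<and> (\<forall>e\<in>edges G. e \<subseteq> verts G \<and> card e = 2)"

definition nbhd :: "'a graph \<Rightarrow> 'a \<Rightarrow> 'a set" where
  "nbhd G v = {u \<in> verts G. {u, v} \<in> edges G}"

(* Unspecified for the graph without vertices. *)
definition min_degree :: "'a graph \<Rightarrow> nat" where
  "min_degree G = Min ((\<lambda>v. card (nbhd G v)) ` verts G)"

(* In a simple graph, the edge {x, y} has x \<noteq> y. If e1 and e2 share an endvertex,
   an e other than e1 and e2 as below is the edge that closes a triangle. *)
definition eop_set :: "'a graph \<Rightarrow> 'a set set \<Rightarrow> bool" where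
  "eop_set G B \<longleftrightarrow>
     B \<subseteq> edges G \<and>
     (\<forall>e1\<in>B. \<forall>e2\<in>B. e1 \<noteq> e2 \<longrightarrow>
        \<not> (\<exists>e\<in>edges G - {e1, e2}. \<exists>x\<in>e1. \<exists>y\<in>e2. e = {x, y}))"

definition eop_number :: "'a graph \<Rightarrow> nat" where
  "eop_number G = Max (card ` {B. eop_set G B})"

definition open_packing :: "'a graph \<Rightarrow> 'a set \<Rightarrow> bool" where
  "open_packing G P \<longleftrightarrow>
     P \<subseteq> verts G \<and> (\<forall>u\<in>P. \<forall>v\<in>P. u \<noteq> v \<longrightarrow> nbhd G u \<inter> nbhd G v = {})"

definition open_packing_number :: "'a graph \<Rightarrow> nat" where
  "open_packing_number G = Max (card ` {P. open_packing G P})"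

definition direct_product :: "'a graph \<Rightarrow> 'b graph \<Rightarrow> ('a \<times> 'b) graph" where
  "direct_product G H =
     Graph (verts G \<times> verts H)
       {{(g, h), (g', h')} |g h g' h'. {g, g'} \<in> edges G \<and> {h, h'} \<in> edges H}"

end

theory Submission
  imports Defs
begin

text \<open>An edge open packing set \<open>B\<close> of \<open>G\<close> is a disjoint union of induced stars with no further edges
  between them, so its edges can be oriented consistently, from the centre \<open>c\<close> of a star to a
  leaf \<open>l\<close>. Given an open packing \<open>P\<close> of \<open>H\<close>, the edges between \<open>(c, h)\<close> and \<open>(l, h')\<close> with
  \<open>h \<in> P\<close> and \<open>h' \<in> N(h)\<close> again form induced stars in the direct product, where disjointness of
  the neighbourhoods keeps stars with different \<open>h\<close> apart. There are at least
  \<open>|B| \<delta>(H) |P|\<close> such edges. Equality holds for two copies of the complete graph on two vertices.\<close>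

section \<open>Finiteness, and extremal sets attaining the parameters\<close>

lemma finite_edges:
  assumes "finite_simple_graph G"
  shows "finite (edges G)"
proof (rule finite_subset)
  show "edges G \<subseteq> Pow (verts G)" "finite (Pow (verts G))"
    using assms by (auto simp: finite_simple_graph_def)
qed

lemma edge_in_vertsD:
  assumes "finite_simple_graph G" "{x, y} \<in> edges G"
  shows "x \<in> verts G" "y \<in> verts G" "x \<noteq> y"
  using assms by (fastforce simp: finite_simple_graph_def)+

lemma finite_eop_sets:
  assumes "finite (edges G)"
  shows "finite {B. eop_set G B}"
  by (rule finite_subset[of _ "Pow (edges G)"]) (use assms in \<open>auto simp: eop_set_def\<close>)

lemma card_le_eop_number:
  assumes "finite (edges G)" "eop_set G B"
  shows "card B \<le> eop_number G"
  unfolding eop_number_def by (rule Max_ge) (use assms finite_eop_sets in auto)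

lemma eop_number_attained:
  assumes "finite (edges G)"
  obtains B where "eop_set G B" "card B = eop_number G"
proof -
  \<comment> \<open>The empty set makes the family nonempty, so the maximum of the cardinalities is
    a genuine one and is attained.\<close>
  have "eop_set G {}" by (simp add: eop_set_def)
  then have "eop_number G \<in> card ` {B. eop_set G B}"
    unfolding eop_number_def by (intro Max_in) (use assms finite_eop_sets in auto)
  with that show thesis by auto
qed

text \<open>Serves as the upper bound in the sharpness example.\<close>

lemma eop_number_le_card_edges:
  assumes "finite (edges G)"
  shows "eop_number G \<le> card (edges G)"
  using eop_number_attained[OF assms] assms by (metis card_mono eop_set_def)

lemma finite_open_packings:
  assumes "finite (verts G)"
  shows "finite {P. open_packing G P}"
  by (rule finite_subset[of _ "Pow (verts G)"]) (use assms in \<open>auto simp: open_packing_def\<close>)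

lemma card_le_open_packing_number:
  assumes "finite (verts G)" "open_packing G P"
  shows "card P \<le> open_packing_number G"
  unfolding open_packing_number_def by (rule Max_ge) (use assms finite_open_packings in auto)

lemma open_packing_number_attained:
  assumes "finite (verts G)"
  obtains P where "open_packing G P" "card P = open_packing_number G"
proof -
  have "open_packing G {}" by (simp add: open_packing_def)
  then have "open_packing_number G \<in> card ` {P. open_packing G P}"
    unfolding open_packing_number_def by (intro Max_in) (use assms finite_open_packings in auto)
  with that show thesis by auto
qed

lemma min_degree_le:
  assumes "finite (verts G)" "v \<in> verts G"
  shows "min_degree G \<le> card (nbhd G v)"
  unfolding min_degree_def by (rule Min_le) (use assms in auto)

section \<open>Edges of the direct product\<close>

lemma direct_product_edge_iff:
  "{(g, h), (g', h')} \<in> edges (direct_product G H) \<longleftrightarrow> {g, g'} \<in> edges G \<and> {h, h'} \<in> edges H"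
  by (auto simp: direct_product_def doubleton_eq_iff insert_commute)

lemma direct_product_edgeE:
  assumes "e \<in> edges (direct_product G H)"
  obtains g h g' h' where "e = {(g, h), (g', h')}" "{g, g'} \<in> edges G" "{h, h'} \<in> edges H"
  using assms by (auto simp: direct_product_def)

lemma finite_simple_direct_product:
  assumes G: "finite_simple_graph G" and H: "finite_simple_graph H"
  shows "finite_simple_graph (direct_product G H)"
  unfolding finite_simple_graph_def
proof (intro conjI ballI)
  show "finite (verts (direct_product G H))"
    using assms by (simp add: direct_product_def finite_simple_graph_def)
next
  fix e assume "e \<in> edges (direct_product G H)"
  then obtain g h g' h' where "e = {(g, h), (g', h')}" "{g, g'} \<in> edges G" "{h, h'} \<in> edges H"
    by (rule direct_product_edgeE)
  with edge_in_vertsD[OF G] edge_in_vertsD[OF H]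
  show "e \<subseteq> verts (direct_product G H)" "card e = 2"
    by (auto simp: direct_product_def card_2_iff)
qed

section \<open>Centres and leaves in an edge open packing set\<close>

lemma eop_setD:
  assumes "eop_set G B" "e1 \<in> B" "e2 \<in> B" "e1 \<noteq> e2" "{x, y} \<in> edges G" "x \<in> e1" "y \<in> e2"
  shows "{x, y} = e1 \<or> {x, y} = e2"
  using assms unfolding eop_set_def by blast

text \<open>If both ends of an edge \<open>e\<close> of \<open>B\<close> lay on other edges
  \<open>f\<close> and \<open>f'\<close> of \<open>B\<close>, then \<open>e\<close> would be a
  forbidden edge joining \<open>f\<close> to \<open>f'\<close>. So some end of \<open>e\<close> lies
  on no other edge of \<open>B\<close>. Such an end is taken as the leaf \<open>l e\<close>, and the
  other end is the centre \<open>c e\<close>; an edge disjoint from all others may be oriented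
  either way.\<close>

lemma eop_set_orientation:
  assumes G: "finite_simple_graph G" and B: "eop_set G B"
  obtains c l where
    "\<And>e. e \<in> B \<Longrightarrow> e = {c e, l e}"
    "\<And>e. e \<in> B \<Longrightarrow> c e \<noteq> l e"
    "\<And>e f. e \<in> B \<Longrightarrow> f \<in> B \<Longrightarrow> e \<noteq> f \<Longrightarrow> e \<inter> f \<subseteq> {c e}"
proof -
  have "\<exists>c l. e = {c, l} \<and> c \<noteq> l \<and> (\<forall>f\<in>B. e \<noteq> f \<longrightarrow> e \<inter> f \<subseteq> {c})" if e: "e \<in> B" for e
  proof -
    have eE: "e \<in> edges G" "card e = 2"
      using e B G by (auto simp: eop_set_def finite_simple_graph_def)
    then obtain u v where uv: "e = {u, v}" "u \<noteq> v"
      by (auto simp: card_2_iff)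
    have "\<not> (\<exists>f\<in>B. \<exists>f'\<in>B. f \<noteq> e \<and> f' \<noteq> e \<and> u \<in> f \<and> v \<in> f')"
    proof clarify
      fix f f' assume *: "f \<in> B" "f' \<in> B" "f \<noteq> e" "f' \<noteq> e" "u \<in> f" "v \<in> f'"
      have "card f = 2"
        using * B G by (auto simp: eop_set_def finite_simple_graph_def)
      \<comment> \<open>A common edge would contain both \<open>u\<close> and \<open>v\<close> and
        hence be \<open>e\<close>.\<close>
      then have "f \<noteq> f'"
        using * uv by (auto simp: card_2_iff)
      from eop_setD[OF B *(1,2) this, of u v] show False
        using * uv eE by auto
    qed
    then consider "\<forall>f\<in>B. f \<noteq> e \<longrightarrow> u \<notin> f" | "\<forall>f\<in>B. f \<noteq> e \<longrightarrow> v \<notin> f"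
      by blast
    then show ?thesis
    proof cases
      case 1
      then have "e = {v, u} \<and> v \<noteq> u \<and> (\<forall>f\<in>B. e \<noteq> f \<longrightarrow> e \<inter> f \<subseteq> {v})"
        using uv by auto
      then show ?thesis by blast
    next
      case 2
      then have "e = {u, v} \<and> u \<noteq> v \<and> (\<forall>f\<in>B. e \<noteq> f \<longrightarrow> e \<inter> f \<subseteq> {u})"
        using uv by auto
      then show ?thesis by blast
    qed
  qed
  then have "\<forall>e\<in>B. \<exists>c l. e = {c, l} \<and> c \<noteq> l \<and> (\<forall>f\<in>B. e \<noteq> f \<longrightarrow> e \<inter> f \<subseteq> {c})"
    by simp
  from bchoice[OF this] obtain c where
    "\<forall>e\<in>B. \<exists>l. e = {c e, l} \<and> c e \<noteq> l \<and> (\<forall>f\<in>B. e \<noteq> f \<longrightarrow> e \<inter> f \<subseteq> {c e})" ..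
  from bchoice[OF this] obtain l where
    cl: "\<forall>e\<in>B. e = {c e, l e} \<and> c e \<noteq> l e \<and> (\<forall>f\<in>B. e \<noteq> f \<longrightarrow> e \<inter> f \<subseteq> {c e})" ..
  show thesis
  proof (rule that)
    show "e = {c e, l e}" if "e \<in> B" for e by (rule bspec[OF cl that, THEN conjunct1])
    show "c e \<noteq> l e" if "e \<in> B" for e using bspec[OF cl that] by simp
    show "e \<inter> f \<subseteq> {c e}" if "e \<in> B" "f \<in> B" "e \<noteq> f" for e f using bspec[OF cl that(1)] that by simp
  qed
qed

section \<open>The first term of the maximum\<close>

lemma eop_number_direct_product_ge:
  fixes G :: "'a graph" and H :: "'b graph"
  assumes G: "finite_simple_graph G" and H: "finite_simple_graph H"
  shows "eop_number G * min_degree H * open_packing_number H \<le> eop_number (direct_product G H)"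
proof -
  have fin: "finite (edges G)" "finite (verts H)"
    using G H finite_edges by (auto simp: finite_simple_graph_def)
  obtain B where B: "eop_set G B" and cardB: "card B = eop_number G"
    using eop_number_attained fin by blast
  obtain P where P: "open_packing H P" and cardP: "card P = open_packing_number H"
    using open_packing_number_attained fin by blast
  obtain c l where
    cl: "\<And>e. e \<in> B \<Longrightarrow> e = {c e, l e}" and
    ne: "\<And>e. e \<in> B \<Longrightarrow> c e \<noteq> l e" and
    share: "\<And>e f. e \<in> B \<Longrightarrow> f \<in> B \<Longrightarrow> e \<noteq> f \<Longrightarrow> e \<inter> f \<subseteq> {c e}"
    using eop_set_orientation[OF G B] by blast
  \<comment> \<open>A vertex shared by two edges of \<open>B\<close> is the centre of both, by
    \<open>share\<close> applied in both orders.\<close>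
  have same: "c e = x" "c f = x" if "e \<in> B" "f \<in> B" "e \<noteq> f" "x \<in> e" "x \<in> f" for e f x
    using share[of e f] share[of f e] that by auto
  have mem: "c e \<in> e" "l e \<in> e" if "e \<in> B" for e
    using insertI1[of "c e" "{l e}"] insertI2[OF singletonI, of "l e" "c e"]
    by (simp_all add: cl[OF that, symmetric])

  \<comment> \<open>Such an edge would be \<open>e\<close> or \<open>f\<close> itself, so one of the
    two centres would lie on both edges. By \<open>same\<close> the centres would then coincide,
    making the edge a loop.\<close>
  have centres: "{c e, c f} \<notin> edges G" if "e \<in> B" "f \<in> B" for e f
  proof
    assume *: "{c e, c f} \<in> edges G"
    have "c e \<noteq> c f" using edge_in_vertsD[OF G *] by auto
    then have "e \<noteq> f" by auto
    from eop_setD[OF B that this *] mem that have "c f \<in> e \<or> c e \<in> f" by auto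
    with same(1)[OF that \<open>e \<noteq> f\<close>, of "c f"] same(2)[OF that \<open>e \<noteq> f\<close>, of "c e"]
    show False using mem that \<open>c e \<noteq> c f\<close> by auto
  qed
  \<comment> \<open>Again the edge would be \<open>e\<close> or \<open>f\<close>, so a leaf would be
    shared and by \<open>same\<close> equal to its own centre.\<close>
  have leaves: "{l e, l f} \<notin> edges G" if "e \<in> B" "f \<in> B" for e f
  proof
    assume *: "{l e, l f} \<in> edges G"
    have "l e \<noteq> l f" using edge_in_vertsD[OF G *] by auto
    then have "e \<noteq> f" by auto
    from eop_setD[OF B that this *] mem that have "l f \<in> e \<or> l e \<in> f" by auto
    with same(2)[OF that \<open>e \<noteq> f\<close>, of "l f"] same(1)[OF that \<open>e \<noteq> f\<close>, of "l e"]
    show False using mem ne that by auto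
  qed
  \<comment> \<open>For distinct edges, the joining edge is \<open>e\<close> or \<open>f\<close>.
    The leaf \<open>l f\<close> cannot be shared, so \<open>c e\<close> lies on \<open>f\<close>,
    and \<open>same\<close> identifies the centres.\<close>
  have centre_leaf: "c e = c f" if "e \<in> B" "f \<in> B" "{c e, l f} \<in> edges G" for e f
  proof (cases "e = f")
    case False
    from eop_setD[OF B that(1,2) False that(3)] mem that have "l f \<in> e \<or> c e \<in> f" by auto
    with same(2)[OF that(1,2) False, of "l f"] same(2)[OF that(1,2) False, of "c e"]
    show ?thesis using mem ne that by auto
  qed simp

  \<comment> \<open>The packing vertex \<open>h\<close> always goes with the centre and its
    neighbour \<open>h'\<close> with the leaf. The edges with the same \<open>c e\<close> and
    \<open>h\<close> thus form a star centred at \<open>(c e, h)\<close>.\<close>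
  define S where "S = B \<times> (SIGMA h:P. nbhd H h)"
  define F where "F = (\<lambda>(e, h, h'). {(c e, h), (l e, h' :: 'b)})"
  have PV: "P \<subseteq> verts H"
    using P by (simp add: open_packing_def)
  have edgesB: "{c e, l e} \<in> edges G" if "e \<in> B" for e
    using B that by (auto simp: eop_set_def cl[OF that, symmetric])

  \<comment> \<open>Project \<open>e'\<close> to \<open>G\<close>. Two centres or two leaves cannot
    be adjacent there. If a centre is joined to a leaf, \<open>centre_leaf\<close> gives equal
    centres. The second coordinates then give a common neighbour of \<open>h\<close> and
    \<open>k\<close>, so \<open>h = k\<close> by the packing property, and \<open>e'\<close> is the
    member that contains this leaf.\<close>
  have star: "e' = {(c e, h), (l e, h')} \<or> e' = {(c f, k), (l f, k')}"
    if "e \<in> B" "f \<in> B" "h \<in> P" "k \<in> P" "h' \<in> nbhd H h" "k' \<in> nbhd H k"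
      and xy: "x \<in> {(c e, h), (l e, h')}" "y \<in> {(c f, k), (l f, k')}"
      "e' = {x, y}" "e' \<in> edges (direct_product G H)"
    for e f h h' k k' x y e'
  proof -
    have packing: "h = k" if "h' \<in> nbhd H h" "h' \<in> nbhd H k" "h \<in> P" "k \<in> P" for h k h'
      using P that unfolding open_packing_def by blast
    have nb: "u \<in> nbhd H v" if "{v, u} \<in> edges H" for u v
      using that edge_in_vertsD[OF H that] by (simp add: nbhd_def insert_commute)
    consider "x = (c e, h)" "y = (c f, k)" | "x = (c e, h)" "y = (l f, k')"
      | "x = (l e, h')" "y = (c f, k)" | "x = (l e, h')" "y = (l f, k')"
      using xy by auto
    then show ?thesis
    proof cases
      case 1
      then show ?thesis using that centres[of e f] by (simp add: direct_product_edge_iff)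
    next
      case 2
      then have *: "{c e, l f} \<in> edges G" "{h, k'} \<in> edges H"
        using that(9,10) by (simp_all add: direct_product_edge_iff)
      have "c e = c f" using centre_leaf * that by blast
      moreover have "h = k" using packing[of k' h k] nb * that by blast
      ultimately show ?thesis using 2 that(9) by simp
    next
      case 3
      then have *: "{c f, l e} \<in> edges G" "{k, h'} \<in> edges H"
        using that(9,10) by (simp_all add: direct_product_edge_iff insert_commute)
      have "c f = c e" using centre_leaf * that by blast
      moreover have "k = h" using packing[of h' k h] nb * that by blast
      ultimately show ?thesis using 3 that(9) by (simp add: insert_commute)
    next
      case 4
      then show ?thesis using that leaves[of e f] by (simp add: direct_product_edge_iff)
    qed
  qed

  have "F ` S \<subseteq> edges (direct_product G H)"
    using edgesB
    by (auto simp: F_def S_def direct_product_edge_iff nbhd_def insert_commute)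
  then have eop: "eop_set (direct_product G H) (F ` S)"
    unfolding eop_set_def
  proof (intro conjI ballI impI notI)
    fix e1 e2
    assume "e1 \<in> F ` S" "e2 \<in> F ` S"
      and ex: "\<exists>e\<in>edges (direct_product G H) - {e1, e2}. \<exists>x\<in>e1. \<exists>y\<in>e2. e = {x, y}"
    have S_E: "\<exists>e h h'. e \<in> B \<and> h \<in> P \<and> h' \<in> nbhd H h \<and> e' = {(c e, h), (l e, h')}"
      if "e' \<in> F ` S" for e'
      using that by (force simp: F_def S_def)
    obtain e h h' f k k' where
      *: "e \<in> B" "f \<in> B" "h \<in> P" "k \<in> P" "h' \<in> nbhd H h" "k' \<in> nbhd H k"
        "e1 = {(c e, h), (l e, h')}" "e2 = {(c f, k), (l f, k')}"
      using S_E[OF \<open>e1 \<in> F ` S\<close>] S_E[OF \<open>e2 \<in> F ` S\<close>] by blast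
    from ex obtain e' x y where
      "e' \<in> edges (direct_product G H)" "e' \<noteq> e1" "e' \<noteq> e2" "x \<in> e1" "y \<in> e2" "e' = {x, y}"
      by blast
    with star[OF *(1-6), of x y e'] *(7,8) show False by simp
  qed

  have inj: "inj_on F S"
  proof (rule inj_onI)
    fix p q assume pq: "p \<in> S" "q \<in> S" "F p = F q"
    obtain e h h' where p: "p = (e, h, h')" by (cases p)
    obtain f k k' where q: "q = (f, k, k')" by (cases q)
    have ef: "e \<in> B" "f \<in> B" using pq by (auto simp: p q S_def)
    have "{(c e, h), (l e, h')} = {(c f, k), (l f, k')}"
      using pq by (simp add: p q F_def)
    \<comment> \<open>Matching the vertices in reversed order also yields \<open>e = f\<close>, but
      then \<open>c e = l e\<close>, against \<open>ne\<close>.\<close>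
    then have "c e = c f \<and> h = k \<and> l e = l f \<and> h' = k' \<or> c e = l f \<and> l e = c f"
      by (auto simp: doubleton_eq_iff)
    moreover from this have "e = f" using cl ef by (metis insert_commute)
    ultimately show "p = q" using ne ef by (auto simp: p q)
  qed

  have finP: "finite P" and finN: "\<And>h. finite (nbhd H h)"
    using PV fin finite_subset by (auto simp: nbhd_def)
  \<comment> \<open>Minimum degree is applied only at vertices of \<open>P\<close>. If
    \<open>H\<close> has no vertices, then \<open>P\<close> is empty and both sums are 0, whatever
    value \<open>min_degree H\<close> has.\<close>
  have "(\<Sum>h\<in>P. min_degree H) \<le> (\<Sum>h\<in>P. card (nbhd H h))"
    by (intro sum_mono min_degree_le) (use fin PV in auto)
  then have "min_degree H * card P \<le> (\<Sum>h\<in>P. card (nbhd H h))"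
    by (simp add: mult.commute)
  then have "eop_number G * (min_degree H * card P) \<le> card B * (\<Sum>h\<in>P. card (nbhd H h))"
    by (simp add: cardB)
  also have "\<dots> = card (F ` S)"
    using finP finN unfolding card_image[OF inj] by (simp add: S_def card_cartesian_product)
  also have "\<dots> \<le> eop_number (direct_product G H)"
    using card_le_eop_number eop finite_edges finite_simple_direct_product G H by blast
  finally show ?thesis by (simp add: cardP mult.assoc)
qed

text \<open>Swapping coordinates is an isomorphism between the two products, so it carries a maximum
  EOP set to an EOP set of the same size. This transfers the bound with exchanged factors, the
  second term of the maximum, to \<open>direct_product G H\<close>.\<close>

lemma eop_number_direct_product_commute_le:
  fixes G :: "'a graph" and H :: "'b graph"
  assumes G: "finite_simple_graph G" and H: "finite_simple_graph H"
  shows "eop_number (direct_product H G) \<le> eop_number (direct_product G H)"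
proof -
  let ?s = "(`) prod.swap :: ('b \<times> 'a) set \<Rightarrow> ('a \<times> 'b) set"
  have fin: "finite (edges (direct_product G H))" "finite (edges (direct_product H G))"
    using finite_edges finite_simple_direct_product G H by blast+
  have swap_edge: "prod.swap ` e \<in> edges (direct_product G' H')"
    if e: "e \<in> edges (direct_product H' G')" for e :: "('x \<times> 'y) set" and G' H'
    using e by (elim direct_product_edgeE) (simp add: direct_product_edge_iff)
  obtain B where B: "eop_set (direct_product H G) B"
    and cardB: "card B = eop_number (direct_product H G)"
    using eop_number_attained fin by blast
  have "eop_set (direct_product G H) (?s ` B)"
    unfolding eop_set_def
  proof (intro conjI ballI impI notI)
    show "?s ` B \<subseteq> edges (direct_product G H)"
      using B swap_edge by (auto simp: eop_set_def)
  next
    fix e1 e2 assume e12: "e1 \<in> ?s ` B" "e2 \<in> ?s ` B" "e1 \<noteq> e2"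
      and ex: "\<exists>e\<in>edges (direct_product G H) - {e1, e2}. \<exists>x\<in>e1. \<exists>y\<in>e2. e = {x, y}"
    obtain f1 f2 where f: "f1 \<in> B" "f2 \<in> B" "e1 = ?s f1" "e2 = ?s f2"
      using e12 by auto
    \<comment> \<open>A forbidden edge between the images is pulled back along the swap to one
      between \<open>f1\<close> and \<open>f2\<close>.\<close>
    obtain x y where xy: "x \<in> f1" "y \<in> f2" "?s {x, y} \<in> edges (direct_product G H)"
      "?s {x, y} \<noteq> e1" "?s {x, y} \<noteq> e2"
    proof -
      obtain x' y' where
        "x' \<in> e1" "y' \<in> e2" "{x', y'} \<in> edges (direct_product G H)" "{x', y'} \<noteq> e1" "{x', y'} \<noteq> e2"
        using ex by blast
      moreover from this obtain x y where "x \<in> f1" "y \<in> f2" "x' = prod.swap x" "y' = prod.swap y"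
        using f by blast
      ultimately show thesis using that[of x y] by simp
    qed
    obtain x1 x2 y1 y2 where "x = (x1, x2)" "y = (y1, y2)" by (cases x, cases y)
    then have "{x, y} \<in> edges (direct_product H G)"
      using xy(3) by (simp add: direct_product_edge_iff)
    from eop_setD[OF B f(1,2) _ this xy(1,2)] xy f e12 show False by auto
  qed
  then have "card (?s ` B) \<le> eop_number (direct_product G H)"
    using card_le_eop_number fin by blast
  moreover have "card (?s ` B) = card B"
    by (intro card_image inj_onI) (simp add: inj_image_eq_iff)
  ultimately show ?thesis by (simp add: cardB)
qed

lemma eop_number_direct_product_ge_max:
  assumes G: "finite_simple_graph G" and H: "finite_simple_graph H"
  shows "max (eop_number G * min_degree H * open_packing_number H)
             (eop_number H * min_degree G * open_packing_number G)
           \<le> eop_number (direct_product G H)"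
  using eop_number_direct_product_ge[OF G H] eop_number_direct_product_ge[OF H G]
    eop_number_direct_product_commute_le[OF G H]
  by simp

section \<open>Sharpness\<close>

definition K2 :: "nat graph" where
  "K2 = Graph {0, 1} {{0, 1}}"

lemma finite_simple_K2: "finite_simple_graph K2"
  by (simp add: finite_simple_graph_def K2_def)

lemma nbhd_K2: "nbhd K2 0 = {1}" "nbhd K2 1 = {0}"
  by (auto simp: nbhd_def K2_def doubleton_eq_iff)

text \<open>The product of two copies of \<open>K2\<close> consists of two disjoint edges, so its
  EOP number is at most 2. The maximum is at least 1 * 1 * 2: the single edge is an EOP set, all
  degrees are 1, and the neighbourhoods {1} and {0} are disjoint, so both vertices form an open
  packing. The general bound gives the other inequality.\<close>

lemma eop_number_direct_product_K2:
  "eop_number (direct_product K2 K2) = max (eop_number K2 * min_degree K2 * open_packing_number K2)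
     (eop_number K2 * min_degree K2 * open_packing_number K2)" (is "_ = ?m")
proof (rule antisym)
  have fin: "finite (edges K2)" "finite (verts K2)"
    by (simp_all add: K2_def)
  have "eop_set K2 {{0, 1}}"
    by (simp add: eop_set_def K2_def)
  then have 1: "1 \<le> eop_number K2"
    using card_le_eop_number[OF fin(1)] by fastforce
  have 2: "1 \<le> min_degree K2"
    using nbhd_K2 by (simp add: min_degree_def K2_def)
  have "open_packing K2 {0, 1}"
    using nbhd_K2 by (auto simp: open_packing_def K2_def)
  then have 3: "2 \<le> open_packing_number K2"
    using card_le_open_packing_number[OF fin(2)] by fastforce
  have "edges (direct_product K2 K2) \<subseteq> {{(0, 0), (1, 1)}, {(0, 1), (1, 0)}}"
    by (auto simp: direct_product_def K2_def doubleton_eq_iff)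
  then have "card (edges (direct_product K2 K2)) \<le> card {{(0::nat, 0::nat), (1, 1)}, {(0, 1), (1, 0)}}"
    by (intro card_mono) auto
  also have "\<dots> \<le> 2"
    by (simp add: card_insert_if)
  also have "2 \<le> ?m"
    using mult_le_mono[OF mult_le_mono[OF 1 2] 3] by simp
  finally show "eop_number (direct_product K2 K2) \<le> ?m"
    using eop_number_le_card_edges finite_edges finite_simple_direct_product finite_simple_K2
      order_trans by blast
qed (rule eop_number_direct_product_ge_max[OF finite_simple_K2 finite_simple_K2])

theorem theorem4p2:
  "(\<forall>(G :: 'a graph) (H :: 'b graph).
      finite_simple_graph G \<longrightarrow> finite_simple_graph H \<longrightarrow>
      eop_number (direct_product G H) \<ge>
        max (eop_number G * min_degree H * open_packing_number H)
            (eop_number H * min_degree G * open_packing_number G)) \<and>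
   (\<exists>(G :: nat graph) (H :: nat graph).
      finite_simple_graph G \<and> finite_simple_graph H \<and>
      edges G \<noteq> {} \<and> edges H \<noteq> {} \<and>
      eop_number (direct_product G H) =
        max (eop_number G * min_degree H * open_packing_number H)
            (eop_number H * min_degree G * open_packing_number G))"
proof (intro conjI allI impI)
  show "\<exists>(G :: nat graph) (H :: nat graph).
      finite_simple_graph G \<and> finite_simple_graph H \<and>
      edges G \<noteq> {} \<and> edges H \<noteq> {} \<and>
      eop_number (direct_product G H) =
        max (eop_number G * min_degree H * open_packing_number H)
            (eop_number H * min_degree G * open_packing_number G)"
    by (intro exI[of _ K2] conjI finite_simple_K2 eop_number_direct_product_K2)
      (simp_all add: K2_def)
qed (rule eop_number_direct_product_ge_max)

end
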